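(* Let $G$ be a connected graph and let $k\geq 2$ be an even integer. The following conditions are equivalent: (1) $G$ has a $\{K_2,\{C_t : t\geq 3\}\}$-factor; (2) $G$ has a $\{K_2,\{C_{2t+1} : t\geq 1\}\}$-factor; (3) $G$ has a fractional perfect matching; (4) $G$ has a perfect $k$-matching.
   Context: All graphs are finite, simple and undirected. $K_2$ is the complete graph on two vertices and $C_t$ the cycle on $t$ vertices. For a family $\mathcal{H}$ of graphs, an $\mathcal{H}$-factor of $G$ is a spanning subgraph of $G$ each of whose connected components is isomorphic to a member of $\mathcal{H}$; thus a $\{K_2,\{C_t : t\geq 3\}\}$-factor has every component a $K_2$ or a cycle, and a $\{K_2,\{C_{2t+1} : t\geq 1\}\}$-factor has every component a $K_2$ or an odd cycle. $E_G(v)$ is the set of edges of $G$ incident with $v$. A fractional perfect matching of $G$ is a function $f:E(G)\to[0,1]$ with $\sum_{e\in E_G(v)}f(e)=1$ for every $v\in V(G)$. A perfect $k$-matching of $G$ is a function $f:E(G)\to\{0,1,\dots,k\}$ with $\sum_{e\in E_G(v)}f(e)=k$ for every $v\in V(G)$. *)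

theory Defs
  imports Complex_Main
begin

record 'a graph =
  verts :: "'a set"
  edges :: "'a set set"

definition simple_graph :: "'a graph \<Rightarrow> bool" where
  "simple_graph G \<longleftrightarrow>
     finite (verts G) \<and>
     (\<forall>e \<in> edges G. \<exists>u v. u \<in> verts G \<and> v \<in> verts G \<and> u \<noteq> v \<and> e = {u, v})"

definition incident_edges :: "'a graph \<Rightarrow> 'a \<Rightarrow> 'a set set" where
  "incident_edges G v = {e \<in> edges G. v \<in> e}"

definition adj :: "'a graph \<Rightarrow> ('a \<times> 'a) set" where
  "adj G = {(u, v). {u, v} \<in> edges G}"

text \<open>As usual, a connected graph has at least one vertex.\<close>

definition connected_graph :: "'a graph \<Rightarrow> bool" where
  "connected_graph G \<longleftrightarrow>
     verts G \<noteq> {} \<and> (\<forall>u \<in> verts G. \<forall>v \<in> verts G. (u, v) \<in> (adj G)\<^sup>*)"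

definition spanning_subgraph :: "'a graph \<Rightarrow> 'a graph \<Rightarrow> bool" where
  "spanning_subgraph H G \<longleftrightarrow>
     simple_graph H \<and> verts H = verts G \<and> edges H \<subseteq> edges G"

definition component_of :: "'a graph \<Rightarrow> 'a \<Rightarrow> 'a graph" where
  "component_of G v =
     \<lparr>verts = {u \<in> verts G. (v, u) \<in> (adj G)\<^sup>*},
      edges = {e \<in> edges G. e \<subseteq> {u \<in> verts G. (v, u) \<in> (adj G)\<^sup>*}}\<rparr>"

definition components :: "'a graph \<Rightarrow> 'a graph set" where
  "components G = component_of G ` verts G"

definition graph_iso :: "'a graph \<Rightarrow> 'b graph \<Rightarrow> bool" where
  "graph_iso G H \<longleftrightarrow>
     (\<exists>\<phi>. bij_betw \<phi> (verts G) (verts H) \<and>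
        (\<forall>u \<in> verts G. \<forall>v \<in> verts G. {u, v} \<in> edges G \<longleftrightarrow> {\<phi> u, \<phi> v} \<in> edges H))"

definition complete_graph :: "nat \<Rightarrow> nat graph" where
  "complete_graph n =
     \<lparr>verts = {..<n}, edges = {{u, v} |u v. u < n \<and> v < n \<and> u \<noteq> v}\<rparr>"

text \<open>This is the cycle on \<open>t\<close> vertices only for \<open>t \<ge> 3\<close>.\<close>

definition cycle_graph :: "nat \<Rightarrow> nat graph" where
  "cycle_graph t = \<lparr>verts = {..<t}, edges = {{i, (i + 1) mod t} |i. i < t}\<rparr>"

text \<open>The members of the family serve as representatives of isomorphism types, so
  vertices in \<^typ>\<open>nat\<close> are enough for families of finite graphs.\<close>

definition has_factor :: "nat graph set \<Rightarrow> 'a graph \<Rightarrow> bool" where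
  "has_factor \<H> G \<longleftrightarrow>
     (\<exists>H. spanning_subgraph H G \<and> (\<forall>C \<in> components H. \<exists>F \<in> \<H>. graph_iso C F))"

text \<open>Only the values of \<open>f\<close> on edges matter below.\<close>

definition fractional_perfect_matching :: "'a graph \<Rightarrow> ('a set \<Rightarrow> real) \<Rightarrow> bool" where
  "fractional_perfect_matching G f \<longleftrightarrow>
     (\<forall>e \<in> edges G. f e \<in> {0..1}) \<and>
     (\<forall>v \<in> verts G. (\<Sum>e \<in> incident_edges G v. f e) = 1)"

definition perfect_k_matching :: "nat \<Rightarrow> 'a graph \<Rightarrow> ('a set \<Rightarrow> nat) \<Rightarrow> bool" where
  "perfect_k_matching k G f \<longleftrightarrow>
     (\<forall>e \<in> edges G. f e \<in> {0..k}) \<and>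
     (\<forall>v \<in> verts G. (\<Sum>e \<in> incident_edges G v. f e) = k)"

end

theory Submission
  imports Defs "HOL-Combinatorics.Cycles"
begin

text \<open>
  All four conditions are equivalent to the existence of a permutation \<open>\<sigma>\<close> of the vertices that
  moves every vertex to a neighbour.
  A fractional perfect matching yields Hall's condition for the neighbourhoods, since each vertex
  carries total weight 1; the resulting system of distinct representatives is \<open>\<sigma>\<close>. Conversely, giving
  \<open>k / 2\<close> to the edge \<open>{v, \<sigma> v}\<close> once for every vertex \<open>v\<close> gives a perfect \<open>k\<close>-matching.
  The cyclic shifts of the components of a factor combine to such a \<open>\<sigma>\<close>, and conversely the edges
  \<open>{v, \<sigma> v}\<close> form a factor whose components are the orbits of \<open>\<sigma>\<close>. An orbit of even
  length can be cut into orbits of length 2, so if \<open>\<sigma>\<close> is chosen with as many points as possible in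
  orbits of length 2, all other orbits are odd.
\<close>

section \<open>Hall's marriage theorem\<close>

text \<open>Induction on \<open>V\<close>, split by whether some nonempty proper subset
  \<open>S\<close> is tight, that is, has exactly \<open>card S\<close> neighbours. If so,
  \<open>S\<close> and \<open>V - S\<close> are matched separately. If not, every nonempty proper
  subset has a spare neighbour, so any single pair can be chosen and removed.\<close>

theorem hall_marriage:
  fixes N :: "'a \<Rightarrow> 'b set"
  assumes "finite V" and "\<And>v. v \<in> V \<Longrightarrow> finite (N v)"
    and "\<And>S. S \<subseteq> V \<Longrightarrow> card S \<le> card (\<Union>(N ` S))"
  shows "\<exists>R. inj_on R V \<and> (\<forall>v\<in>V. R v \<in> N v)"
  using assms
proof (induction V arbitrary: N rule: finite_psubset_induct)
  case (psubset V)
  have finU: "finite (\<Union>(N ` S))" if "S \<subseteq> V" for S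
    using that psubset.hyps psubset.prems(1) by (meson finite_UN_I finite_subset subsetD)
  show ?case
  proof (cases "V = {}")
    case False
    show ?thesis
    proof (cases "\<exists>S. S \<subset> V \<and> S \<noteq> {} \<and> card (\<Union>(N ` S)) = card S")
      case True
      then obtain S where S: "S \<subset> V" "S \<noteq> {}" "card (\<Union>(N ` S)) = card S" by blast
      obtain R1 where R1: "inj_on R1 S" "\<forall>v\<in>S. R1 v \<in> N v"
      proof -
        have "\<exists>R. inj_on R S \<and> (\<forall>v\<in>S. R v \<in> N v)"
        proof (rule psubset.IH[OF S(1)])
          show "finite (N v)" if "v \<in> S" for v
            using that S(1) psubset.prems(1) by blast
          show "card T \<le> card (\<Union>(N ` T))" if "T \<subseteq> S" for T
            using that S(1) psubset.prems(2) by blast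
        qed
        then show ?thesis using that by blast
      qed
      define M where "M v = N v - \<Union>(N ` S)" for v
      obtain R2 where R2: "inj_on R2 (V - S)" "\<forall>v\<in>V - S. R2 v \<in> M v"
      proof -
        have "\<exists>R. inj_on R (V - S) \<and> (\<forall>v\<in>V - S. R v \<in> M v)"
        proof (rule psubset.IH)
          show "V - S \<subset> V" using S by blast
          show "finite (M v)" if "v \<in> V - S" for v
            using that psubset.prems(1) by (simp add: M_def)
          show "card T \<le> card (\<Union>(M ` T))" if T: "T \<subseteq> V - S" for T
          proof -
            have fin: "finite S" "finite T"
              using S(1) T psubset.hyps by (meson finite_subset psubset_imp_subset Diff_subset)+
            \<comment> \<open>Hall's condition for \<open>T\<close> in the reduced system is the one
              for \<open>T \<union> S\<close> with the tight count of \<open>S\<close> subtracted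
              from both sides.\<close>
            have "card (T \<union> S) \<le> card (\<Union>(N ` (T \<union> S)))"
              using S(1) T psubset.prems(2) by blast
            moreover have "card (T \<union> S) = card T + card S"
              using fin T by (intro card_Un_disjoint) auto
            moreover have "\<Union>(M ` T) = \<Union>(N ` (T \<union> S)) - \<Union>(N ` S)"
              by (auto simp: M_def)
            moreover have "card (\<Union>(N ` (T \<union> S)) - \<Union>(N ` S))
                = card (\<Union>(N ` (T \<union> S))) - card (\<Union>(N ` S))"
              using finU[of S] S(1) by (intro card_Diff_subset) auto
            ultimately show ?thesis using S(3) by simp
          qed
        qed
        then show ?thesis using that by blast
      qed
      have "inj_on (\<lambda>v. if v \<in> S then R1 v else R2 v) V"
      proof (rule inj_onI)
        fix u w assume uw: "u \<in> V" "w \<in> V"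
          and eq: "(if u \<in> S then R1 u else R2 u) = (if w \<in> S then R1 w else R2 w)"
        have in1: "R1 x \<in> \<Union>(N ` S)" if "x \<in> S" for x
          using that R1(2) by blast
        have in2: "R2 x \<notin> \<Union>(N ` S)" if "x \<in> V - S" for x
          using bspec[OF R2(2) that] by (simp add: M_def)
        show "u = w"
        proof (cases "u \<in> S"; cases "w \<in> S")
          assume "u \<in> S" "w \<in> S"
          then show ?thesis using eq inj_onD[OF R1(1)] by simp
        next
          assume "u \<in> S" "w \<notin> S"
          then show ?thesis using eq in1[of u] in2[of w] uw by simp
        next
          assume "u \<notin> S" "w \<in> S"
          then show ?thesis using eq in1[of w] in2[of u] uw by simp
        next
          assume "u \<notin> S" "w \<notin> S"
          then show ?thesis using eq uw inj_onD[OF R2(1)] by simp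
        qed
      qed
      moreover have "\<forall>v\<in>V. (if v \<in> S then R1 v else R2 v) \<in> N v"
        using R1(2) R2(2) by (auto simp: M_def)
      ultimately show ?thesis by blast
    next
      case strict: False
      obtain v where v: "v \<in> V" using False by blast
      have "N v \<noteq> {}" using psubset.prems(2)[of "{v}"] v by auto
      then obtain y where y: "y \<in> N v" by blast
      define M where "M w = N w - {y}" for w
      have "\<exists>R. inj_on R (V - {v}) \<and> (\<forall>w\<in>V - {v}. R w \<in> M w)"
      proof (rule psubset.IH)
        show "V - {v} \<subset> V" using v by blast
        show "finite (M w)" if "w \<in> V - {v}" for w
          using that psubset.prems(1) by (simp add: M_def)
        show "card T \<le> card (\<Union>(M ` T))" if T: "T \<subseteq> V - {v}" for T
        proof (cases "T = {}")
          case False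
          \<comment> \<open>As \<open>T\<close> omits \<open>v\<close> it is a proper subset, hence
            not tight; its spare neighbour makes up for the loss of \<open>y\<close>.\<close>
          have "T \<subset> V" using T v by blast
          then have "card (\<Union>(N ` T)) \<noteq> card T" "card T \<le> card (\<Union>(N ` T))"
            using False strict psubset.prems(2)[of T] by blast+
          then have "card T < card (\<Union>(N ` T))" by linarith
          moreover have "\<Union>(M ` T) = \<Union>(N ` T) - {y}" by (auto simp: M_def)
          moreover have "card (\<Union>(N ` T)) - 1 \<le> card (\<Union>(N ` T) - {y})"
            by (simp add: card_Diff_singleton_if)
          ultimately show ?thesis by simp
        qed simp
      qed
      then obtain R where R: "inj_on R (V - {v})" "\<forall>w\<in>V - {v}. R w \<in> M w" by blast
      have "inj_on (R(v := y)) V"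
      proof (rule inj_onI)
        fix u w assume "u \<in> V" "w \<in> V" and eq: "(R(v := y)) u = (R(v := y)) w"
        moreover have "R x \<noteq> y" if "x \<in> V - {v}" for x
          using R(2) that by (auto simp: M_def)
        ultimately show "u = w"
          using inj_onD[OF R(1), of u w] by (auto split: if_splits)
      qed
      moreover have "\<forall>w\<in>V. (R(v := y)) w \<in> N w"
        using R(2) y by (auto simp: M_def)
      ultimately show ?thesis by blast
    qed
  qed simp
qed

section \<open>Edge permutations\<close>

text \<open>With \<open>permutes\<close>, the map is the identity off \<open>verts G\<close> and so
  a bijection of the whole type; \<open>inv \<sigma>\<close> and the orbit length
  \<open>least_power \<sigma> v\<close> can then be used without restriction.\<close>

definition edge_permutation :: "'a graph \<Rightarrow> ('a \<Rightarrow> 'a) \<Rightarrow> bool" where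
  "edge_permutation G \<sigma> \<longleftrightarrow>
     \<sigma> permutes verts G \<and> (\<forall>v\<in>verts G. {v, \<sigma> v} \<in> edges G)"

lemma edge_neq: "simple_graph G \<Longrightarrow> {u, v} \<in> edges G \<Longrightarrow> u \<noteq> v"
  unfolding simple_graph_def by (metis doubleton_eq_iff insert_absorb2)

lemma edge_in_verts: "simple_graph G \<Longrightarrow> {u, v} \<in> edges G \<Longrightarrow> u \<in> verts G \<and> v \<in> verts G"
  unfolding simple_graph_def by (metis doubleton_eq_iff)

lemma finite_edges: "simple_graph G \<Longrightarrow> finite (edges G)"
proof -
  assume G: "simple_graph G"
  then have "edges G \<subseteq> Pow (verts G)" unfolding simple_graph_def by fastforce
  then show ?thesis using G unfolding simple_graph_def by (meson finite_Pow_iff finite_subset)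
qed

lemma edge_permutation_permutation:
  "simple_graph G \<Longrightarrow> edge_permutation G \<sigma> \<Longrightarrow> permutation \<sigma>"
  unfolding simple_graph_def edge_permutation_def permutation_permutes by blast

lemma edge_permutation_funpow_in:
  "edge_permutation G \<sigma> \<Longrightarrow> v \<in> verts G \<Longrightarrow> (\<sigma> ^^ i) v \<in> verts G"
  unfolding edge_permutation_def by (metis permutes_funpow permutes_in_image)

text \<open>Later constructions control a map on the vertices only; extending it by the identity
  turns it into a permutation.\<close>

lemma bij_betw_imp_edge_permutation:
  assumes "bij_betw \<sigma> (verts G) (verts G)" and "\<forall>v\<in>verts G. {v, \<sigma> v} \<in> edges G"
  shows "\<exists>\<tau>. edge_permutation G \<tau>"
proof
  let ?\<tau> = "\<lambda>v. if v \<in> verts G then \<sigma> v else v"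
  have "bij_betw ?\<tau> (verts G) (verts G)"
    using assms(1) by (rule bij_betw_cong[THEN iffD1, rotated]) simp
  then have "?\<tau> permutes verts G" by (rule bij_imp_permutes) simp
  then show "edge_permutation G ?\<tau>" using assms(2) by (simp add: edge_permutation_def)
qed

text \<open>An orbit of length 1 would give a loop.\<close>

lemma least_power_edge_permutation_ge_2:
  assumes "simple_graph G" and "edge_permutation G \<sigma>" and "v \<in> verts G"
  shows "2 \<le> least_power \<sigma> v"
proof -
  have "\<sigma> v \<noteq> v"
    using assms edge_neq unfolding edge_permutation_def by metis
  then show ?thesis
    using least_power_gt_one[OF edge_permutation_permutation[OF assms(1,2)]] by fastforce
qed

text \<open>Extremal argument: in an edge permutation with the most points in orbits of length 2, a
  longer even orbit could be cut into pairs of consecutive points, contradicting maximality.\<close>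

lemma edge_permutation_no_long_even_orbits:
  assumes G: "simple_graph G" and "edge_permutation G \<sigma>0"
  shows "\<exists>\<sigma>. edge_permutation G \<sigma> \<and>
    (\<forall>v\<in>verts G. odd (least_power \<sigma> v) \<or> least_power \<sigma> v = 2)"
proof -
  \<comment> \<open>Edge permutations fix no vertex, so for them these are exactly the vertices in
    orbits of length 2.\<close>
  define I where "I \<sigma> = {v \<in> verts G. \<sigma> (\<sigma> v) = v}" for \<sigma> :: "'a \<Rightarrow> 'a"
  have fin: "finite (verts G)" using G by (simp add: simple_graph_def)
  have "\<forall>\<tau>. edge_permutation G \<tau> \<longrightarrow> card (I \<tau>) < Suc (card (verts G))"
    using fin by (auto simp: I_def less_Suc_eq_le intro: card_mono)
  from ex_has_greatest_nat[of "edge_permutation G", OF assms(2) this] obtain \<sigma> where \<sigma>: "edge_permutation G \<sigma>"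
    and max: "\<And>\<tau>. edge_permutation G \<tau> \<Longrightarrow> card (I \<tau>) \<le> card (I \<sigma>)" by blast
  have perm: "\<sigma> permutes verts G" and edge: "\<And>v. v \<in> verts G \<Longrightarrow> {v, \<sigma> v} \<in> edges G"
    using \<sigma> by (auto simp: edge_permutation_def)
  have inj: "inj \<sigma>" using perm by (rule permutes_inj)
  note per = edge_permutation_permutation[OF G \<sigma>]
  have False if v: "v \<in> verts G" and ev: "even (least_power \<sigma> v)" and n2: "least_power \<sigma> v \<noteq> 2" for v
  proof -
    let ?n = "least_power \<sigma> v"
    \<comment> \<open>\<open>A\<close> and \<open>B\<close> are the points of the orbit reached from
      \<open>v\<close> in an even and an odd number of steps; they are disjoint because the orbit
      length is even.\<close>
    define A where "A = range (\<lambda>i. (\<sigma> ^^ (2 * i)) v)"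
    define B where "B = \<sigma> ` A"
    have AV: "A \<subseteq> verts G" using edge_permutation_funpow_in[OF \<sigma> v] by (auto simp: A_def)
    have vA: "v \<in> A" unfolding A_def by (metis funpow_0 mult_0_right rangeI)
    have \<sigma>B: "\<sigma> ` B = A"
    proof
      show "\<sigma> ` B \<subseteq> A"
      proof
        fix x assume "x \<in> \<sigma> ` B"
        then obtain i where "x = (\<sigma> ^^ (2 * Suc i)) v" by (auto simp: A_def B_def)
        then show "x \<in> A" unfolding A_def by blast
      qed
      show "A \<subseteq> \<sigma> ` B"
      proof
        fix x assume "x \<in> A"
        then obtain i where x: "x = (\<sigma> ^^ (2 * i)) v" by (auto simp: A_def)
        obtain m where m: "?n = 2 * Suc m"
          using ev least_power_of_permutation(2)[OF per, of v]
          by (metis evenE gr0_implies_Suc nat_0_less_mult_iff)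
        \<comment> \<open>A full turn is added so that two applications of \<open>\<sigma>\<close>
          can be split off even when \<open>i\<close> is 0.\<close>
        have "x = (\<sigma> ^^ (2 * i + ?n)) v"
          using x least_power_of_permutation(1)[OF per, of v] by (simp add: funpow_add)
        also have "\<dots> = \<sigma> (\<sigma> ((\<sigma> ^^ (2 * (i + m))) v))"
          by (simp add: m algebra_simps)
        finally show "x \<in> \<sigma> ` B" unfolding A_def B_def by blast
      qed
    qed
    have disj: "A \<inter> B = {}"
    proof (rule ccontr)
      assume "A \<inter> B \<noteq> {}"
      then obtain i j where ij: "(\<sigma> ^^ (2 * i)) v = (\<sigma> ^^ Suc (2 * j)) v"
        by (auto simp: A_def B_def)
      \<comment> \<open>The exponents differ by a multiple of the even orbit length. Subtraction on
        naturals requires the larger exponent first, hence the use in both orders below.\<close>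
      have "even (a - b)" if "(\<sigma> ^^ a) v = (\<sigma> ^^ b) v" "b \<le> a" for a b
        using funpow_diff[OF inj that(2) that(1)[symmetric]] least_power_minimal ev
        by (metis dvd_trans)
      from this[OF ij] this[OF ij[symmetric]] show False
        by (cases "Suc (2 * j) \<le> 2 * i") auto
    qed
    \<comment> \<open>Each point of \<open>A\<close> is still sent to its successor in
      \<open>B\<close>, but that successor is now sent back; edges being undirected, no new edge is
      needed.\<close>
    define \<tau> where "\<tau> u = (if u \<in> B then inv \<sigma> u else \<sigma> u)" for u
    have invB: "inv \<sigma> u \<in> A" if "u \<in> B" for u
      using that inj by (auto simp: B_def)
    have BV: "B \<subseteq> verts G" using AV perm by (auto simp: B_def permutes_in_image)
    have "edge_permutation G \<tau>"
    proof -
      have "\<sigma> w \<notin> A" if "w \<notin> B" for w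
        using that \<sigma>B inj by (metis image_iff injD)
      \<comment> \<open>The new map sends \<open>B\<close> into \<open>A\<close> and all other
        points outside \<open>A\<close>, so a collision could only occur within one of its two
        branches.\<close>
      then have mixed: "inv \<sigma> u \<noteq> \<sigma> w" if "u \<in> B" "w \<notin> B" for u w
        using that invB by metis
      have inj_inv: "inj (inv \<sigma>)" using perm by (intro permutes_inj permutes_inv)
      have "inj_on \<tau> (verts G)"
      proof (rule inj_onI)
        fix u w assume "\<tau> u = \<tau> w"
        then show "u = w"
          using mixed[of u w] mixed[of w u] injD[OF inj, of u w] injD[OF inj_inv, of u w]
          by (cases "u \<in> B"; cases "w \<in> B") (simp_all add: \<tau>_def)
      qed
      moreover have "\<tau> ` verts G \<subseteq> verts G"
      proof (rule image_subsetI)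
        fix x assume "x \<in> verts G"
        then have "\<sigma> x \<in> verts G" "inv \<sigma> x \<in> verts G"
          using permutes_in_image perm permutes_inv by metis+
        then show "\<tau> x \<in> verts G" by (simp add: \<tau>_def)
      qed
      ultimately have "bij_betw \<tau> (verts G) (verts G)"
        using fin by (simp add: bij_betw_def endo_inj_surj)
      moreover have "\<tau> u = u" if "u \<notin> verts G" for u
        using that BV permutes_not_in[OF perm that] by (auto simp: \<tau>_def)
      ultimately have "\<tau> permutes verts G" by (rule bij_imp_permutes)
      moreover have "{u, \<tau> u} \<in> edges G" if "u \<in> verts G" for u
      proof (cases "u \<in> B")
        case True
        then have "{inv \<sigma> u, \<sigma> (inv \<sigma> u)} \<in> edges G" using edge invB AV by blast
        then show ?thesis
          using True permutes_inverses(1)[OF perm] by (simp add: \<tau>_def insert_commute)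
      qed (use edge[OF that] in \<open>simp add: \<tau>_def\<close>)
      ultimately show ?thesis by (simp add: edge_permutation_def)
    qed
    moreover have "I \<sigma> \<subset> I \<tau>"
    proof
      have twice: "\<tau> (\<tau> u) = u" if "u \<in> A" for u
      proof -
        have "u \<notin> B" "\<sigma> u \<in> B" using that disj by (auto simp: B_def)
        then show ?thesis using inj by (simp add: \<tau>_def)
      qed
      \<comment> \<open>On \<open>A\<close> and \<open>B\<close> the map \<open>\<tau>\<close> is an
        involution anyway; off both sets it agrees with \<open>\<sigma>\<close> at \<open>u\<close>
        and at \<open>\<sigma> u\<close>.\<close>
      have "\<tau> (\<tau> u) = u" if fixed: "\<sigma> (\<sigma> u) = u" for u
      proof (cases "u \<in> B")
        case True
        then have "inv \<sigma> u \<notin> B" using invB disj by blast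
        then show ?thesis using True permutes_inverses(1)[OF perm] by (simp add: \<tau>_def)
      next
        case False
        show ?thesis
        proof (cases "u \<in> A")
          case notA: False
          then have "\<sigma> u \<notin> B" using inj by (simp add: B_def inj_image_mem_iff)
          then show ?thesis using False fixed by (simp add: \<tau>_def)
        qed (rule twice)
      qed
      then show "I \<sigma> \<subseteq> I \<tau>" by (auto simp: I_def)
      \<comment> \<open>Strictness: \<open>v\<close> is newly paired, since an even orbit length
        dividing 2 would be 2.\<close>
      have "\<sigma> (\<sigma> v) \<noteq> v"
      proof
        assume "\<sigma> (\<sigma> v) = v"
        then have "(\<sigma> ^^ 2) v = v" by (simp add: numeral_2_eq_2)
        then have "?n dvd 2" by (rule least_power_minimal)
        then show False using ev n2 by (simp add: dvd_antisym)
      qed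
      then show "I \<sigma> \<noteq> I \<tau>" using twice[OF vA] v unfolding I_def by blast
    qed
    then have "card (I \<sigma>) < card (I \<tau>)"
      using fin by (intro psubset_card_mono) (auto simp: I_def)
    ultimately show False using max by fastforce
  qed
  then show ?thesis using \<sigma> by blast
qed

section \<open>Factors and edge permutations\<close>

text \<open>For two vertices both indices of the cycle produce the same edge. Thus $K_2$ can be
  handled as a degenerate cycle, without a separate case.\<close>

lemma complete_graph_2: "complete_graph 2 = cycle_graph 2"
proof -
  have "{{u, v} |u v::nat. u < 2 \<and> v < 2 \<and> u \<noteq> v} = {{0, 1}}"
    by (auto simp: less_2_cases_iff insert_commute)
  moreover have "{{i, (i + 1) mod 2} |i::nat. i < 2} = {{0, 1}}"
    by (auto simp: less_2_cases_iff insert_commute)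
  ultimately show ?thesis by (simp add: complete_graph_def cycle_graph_def)
qed

section \<open>The factor formed by the orbits of an edge permutation\<close>

definition permutation_graph :: "'a graph \<Rightarrow> ('a \<Rightarrow> 'a) \<Rightarrow> 'a graph" where
  "permutation_graph G \<sigma> = \<lparr>verts = verts G, edges = (\<lambda>v. {v, \<sigma> v}) ` verts G\<rparr>"

lemma permutation_graph_spanning:
  assumes G: "simple_graph G" and \<sigma>: "edge_permutation G \<sigma>"
  shows "spanning_subgraph (permutation_graph G \<sigma>) G"
proof -
  have "edges (permutation_graph G \<sigma>) \<subseteq> edges G"
    using \<sigma> by (auto simp: permutation_graph_def edge_permutation_def)
  then show ?thesis
    using G unfolding spanning_subgraph_def simple_graph_def
    by (auto simp: permutation_graph_def)
qed

lemma permutation_graph_edge_iff: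
  assumes G: "simple_graph G" and \<sigma>: "edge_permutation G \<sigma>"
  shows "{u, w} \<in> edges (permutation_graph G \<sigma>) \<longleftrightarrow>
    u \<in> verts G \<and> w \<in> verts G \<and> (w = \<sigma> u \<or> u = \<sigma> w)"
proof -
  have "\<sigma> x \<in> verts G \<longleftrightarrow> x \<in> verts G" for x
    using \<sigma> by (simp add: edge_permutation_def permutes_in_image)
  then show ?thesis
    by (auto simp: permutation_graph_def doubleton_eq_iff)
qed

text \<open>Every edge leads one step forward or backward along \<open>\<sigma>\<close>, and in a
  finite orbit a backward step is a sequence of forward steps. So the component of \<open>v\<close>
  is its orbit.\<close>

lemma permutation_graph_reachable_iff:
  assumes G: "simple_graph G" and \<sigma>: "edge_permutation G \<sigma>" and v: "v \<in> verts G"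
  shows "(v, u) \<in> (adj (permutation_graph G \<sigma>))\<^sup>* \<longleftrightarrow> (\<exists>i < least_power \<sigma> v. u = (\<sigma> ^^ i) v)"
proof -
  let ?n = "least_power \<sigma> v"
  note per = edge_permutation_permutation[OF G \<sigma>]
  have n: "(\<sigma> ^^ ?n) v = v" "?n > 0" using least_power_of_permutation[OF per] by auto
  have inj: "inj \<sigma>" using \<sigma> by (auto simp: edge_permutation_def intro: permutes_inj)
  have bounded: "\<exists>i < ?n. (\<sigma> ^^ j) v = (\<sigma> ^^ i) v" for j
    using funpow_mod_eq[OF n(1), of j] n(2) by (metis mod_less_divisor)
  have "\<exists>i. u = (\<sigma> ^^ i) v" if "(v, u) \<in> (adj (permutation_graph G \<sigma>))\<^sup>*"
    using that
  proof induction
    case base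
    show ?case by (metis funpow_0)
  next
    case (step u w)
    then obtain i where i: "u = (\<sigma> ^^ i) v" by blast
    from step.hyps(2) consider "w = \<sigma> u" | "u = \<sigma> w"
      by (auto simp: adj_def permutation_graph_edge_iff[OF G \<sigma>])
    then show ?case
    proof cases
      case 1
      then have "w = (\<sigma> ^^ Suc i) v" by (simp add: i)
      then show ?thesis by blast
    next
      case 2
      \<comment> \<open>The extra full turn makes the exponent positive, so that one
        \<open>\<sigma>\<close> can be cancelled.\<close>
      have "\<sigma> w = (\<sigma> ^^ (i + ?n)) v" using 2 i n(1) by (simp add: funpow_add)
      also have "\<dots> = \<sigma> ((\<sigma> ^^ (i + ?n - 1)) v)"
        using n(2) by (metis Suc_pred add_gr_0 comp_apply funpow.simps(2) One_nat_def)
      finally show ?thesis using inj by (auto dest: injD)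
    qed
  qed
  moreover have "(v, (\<sigma> ^^ i) v) \<in> (adj (permutation_graph G \<sigma>))\<^sup>*" for i
  proof (induction i)
    case (Suc i)
    have "((\<sigma> ^^ i) v, (\<sigma> ^^ Suc i) v) \<in> adj (permutation_graph G \<sigma>)"
      using edge_permutation_funpow_in[OF \<sigma> v, of i] by (auto simp: adj_def permutation_graph_def)
    with Suc show ?case by (rule rtrancl_into_rtrancl)
  qed simp
  ultimately show ?thesis using bounded by metis
qed

text \<open>Numbering the orbit by \<open>p i = (\<sigma> ^^ i) v\<close> turns
  \<open>\<sigma>\<close> into the successor modulo the orbit length, which is the adjacency of
  \<open>cycle_graph\<close>.\<close>

lemma permutation_graph_component_iso:
  assumes G: "simple_graph G" and \<sigma>: "edge_permutation G \<sigma>" and v: "v \<in> verts G"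
  shows "graph_iso (component_of (permutation_graph G \<sigma>) v) (cycle_graph (least_power \<sigma> v))"
proof -
  let ?H = "permutation_graph G \<sigma>" and ?n = "least_power \<sigma> v"
  note per = edge_permutation_permutation[OF G \<sigma>]
  define p where "p i = (\<sigma> ^^ i) v" for i
  have n: "p ?n = v" "?n > 0" using least_power_of_permutation[OF per] by (auto simp: p_def)
  have pV: "p i \<in> verts G" for i
    unfolding p_def by (rule edge_permutation_funpow_in[OF \<sigma> v])
  have verts: "verts (component_of ?H v) = p ` {..<?n}"
  proof -
    have "verts (component_of ?H v) = {u \<in> verts G. \<exists>i<?n. u = p i}"
      unfolding component_of_def p_def permutation_graph_reachable_iff[OF G \<sigma> v]
      by (simp add: permutation_graph_def)
    then show ?thesis using pV by auto
  qed
  have inj: "inj_on p {..<?n}"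
  proof -
    \<comment> \<open>Otherwise \<open>j - i\<close> would be a positive period below the least
      one.\<close>
    have "i = j" if "i \<le> j" "j < ?n" "p i = p j" for i j
    proof (rule ccontr)
      assume "i \<noteq> j"
      have "(\<sigma> ^^ (j - i)) v = v"
        using funpow_diff that \<sigma> permutes_inj unfolding p_def edge_permutation_def by metis
      then have "?n \<le> j - i" using that \<open>i \<noteq> j\<close> by (intro least_power_le) auto
      then show False using that \<open>i \<noteq> j\<close> by linarith
    qed
    then show ?thesis
      unfolding inj_on_def by (metis lessThan_iff nle_le)
  qed
  have edge_iff: "{p i, p j} \<in> edges (component_of ?H v) \<longleftrightarrow> {i, j} \<in> edges (cycle_graph ?n)"
    if ij: "i < ?n" "j < ?n" for i j
  proof -
    have succ: "\<sigma> (p a) = p (Suc a mod ?n)" for a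
      using funpow_mod_eq[OF n(1)[unfolded p_def], of "Suc a"] by (simp add: p_def)
    have step: "p b = \<sigma> (p a) \<longleftrightarrow> b = Suc a mod ?n" if "b < ?n" for a b
      using inj_onD[OF inj, of b "Suc a mod ?n"] that n(2) by (auto simp: succ)
    have "{p i, p j} \<in> edges (component_of ?H v) \<longleftrightarrow> {p i, p j} \<in> edges ?H"
      using verts ij by (auto simp: component_of_def)
    also have "\<dots> \<longleftrightarrow> j = Suc i mod ?n \<or> i = Suc j mod ?n"
      unfolding permutation_graph_edge_iff[OF G \<sigma>] using pV step ij by auto
    also have "\<dots> \<longleftrightarrow> {i, j} \<in> edges (cycle_graph ?n)"
      using ij by (auto simp: cycle_graph_def doubleton_eq_iff)
    finally show ?thesis .
  qed
  have bij: "bij_betw p {..<?n} (verts (component_of ?H v))"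
    using inj verts by (simp add: bij_betw_def)
  let ?q = "inv_into {..<?n} p"
  have "bij_betw ?q (verts (component_of ?H v)) (verts (cycle_graph ?n))"
    using bij_betw_inv_into[OF bij] by (simp add: cycle_graph_def)
  moreover have "{a, b} \<in> edges (component_of ?H v) \<longleftrightarrow> {?q a, ?q b} \<in> edges (cycle_graph ?n)"
    if ab: "a \<in> verts (component_of ?H v)" "b \<in> verts (component_of ?H v)" for a b
  proof -
    obtain i j where "i < ?n" "j < ?n" "a = p i" "b = p j" using ab unfolding verts by blast
    then show ?thesis using edge_iff inj by simp
  qed
  ultimately show ?thesis unfolding graph_iso_def by blast
qed

text \<open>After the long even orbits are removed, an orbit has length 2 or odd length; the latter
  is at least 3 because there are no fixed vertices.\<close>

lemma edge_permutation_imp_factor: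
  assumes G: "simple_graph G" and "edge_permutation G \<sigma>0"
  shows "has_factor ({complete_graph 2} \<union> {cycle_graph (2 * t + 1) |t. t \<ge> 1}) G"
proof -
  obtain \<sigma> where \<sigma>: "edge_permutation G \<sigma>"
    and orb: "\<And>v. v \<in> verts G \<Longrightarrow> odd (least_power \<sigma> v) \<or> least_power \<sigma> v = 2"
    using edge_permutation_no_long_even_orbits[OF assms] by blast
  have "\<exists>F \<in> {complete_graph 2} \<union> {cycle_graph (2 * t + 1) |t. t \<ge> 1}. graph_iso C F"
    if C: "C \<in> components (permutation_graph G \<sigma>)" for C
  proof -
    obtain v where v: "v \<in> verts G" and C: "C = component_of (permutation_graph G \<sigma>) v"
      using C by (auto simp: components_def permutation_graph_def)
    have iso: "graph_iso C (cycle_graph (least_power \<sigma> v))"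
      unfolding C by (rule permutation_graph_component_iso[OF G \<sigma> v])
    from orb[OF v] show ?thesis
    proof
      assume "odd (least_power \<sigma> v)"
      then obtain t where t: "least_power \<sigma> v = 2 * t + 1" by (rule oddE)
      then have "t \<ge> 1" using least_power_edge_permutation_ge_2[OF G \<sigma> v] by linarith
      then show ?thesis using iso t by auto
    next
      assume "least_power \<sigma> v = 2"
      then show ?thesis using iso complete_graph_2 by auto
    qed
  qed
  then show ?thesis
    using permutation_graph_spanning[OF G \<sigma>] unfolding has_factor_def by blast
qed

section \<open>From a factor to an edge permutation\<close>

lemma bij_betw_shift_cycle_graph:
  fixes t :: nat
  assumes "t > 0"
  shows "bij_betw (\<lambda>i. (i + 1) mod t) {..<t} {..<t}"
proof -
  have "inj_on (\<lambda>i. (i + 1) mod t) {..<t}"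
    by (auto simp: inj_on_def mod_Suc split: if_splits)
  moreover have "(\<lambda>i. (i + 1) mod t) ` {..<t} \<subseteq> {..<t}" using assms by auto
  ultimately show ?thesis by (simp add: bij_betw_def endo_inj_surj)
qed

text \<open>Rotation by one step moves each vertex of the cycle to a neighbour, and the isomorphism
  carries it over to \<open>C\<close>. For \<open>t = 2\<close> it swaps the ends of the
  edge.\<close>

lemma iso_cycle_graph_shift:
  assumes "graph_iso C (cycle_graph t)" and "t \<ge> 2"
  shows "\<exists>\<sigma>. bij_betw \<sigma> (verts C) (verts C) \<and> (\<forall>v\<in>verts C. {v, \<sigma> v} \<in> edges C)"
proof -
  obtain \<phi> where bij: "bij_betw \<phi> (verts C) {..<t}"
    and edge: "\<And>u v. u \<in> verts C \<Longrightarrow> v \<in> verts C \<Longrightarrow>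
      {u, v} \<in> edges C \<longleftrightarrow> {\<phi> u, \<phi> v} \<in> edges (cycle_graph t)"
    using assms(1) unfolding graph_iso_def by (auto simp: cycle_graph_def)
  let ?\<psi> = "inv_into (verts C) \<phi>" and ?s = "\<lambda>i. (i + 1) mod t"
  have "bij_betw ?s {..<t} {..<t}"
    using assms(2) by (intro bij_betw_shift_cycle_graph) simp
  then have "bij_betw (?\<psi> \<circ> (?s \<circ> \<phi>)) (verts C) (verts C)"
    using bij bij_betw_inv_into[OF bij] by (meson bij_betw_trans)
  moreover have "{v, (?\<psi> \<circ> (?s \<circ> \<phi>)) v} \<in> edges C" if v: "v \<in> verts C" for v
  proof -
    have \<phi>v: "\<phi> v < t" using bij v by (auto dest: bij_betwE)
    have s: "?s (\<phi> v) \<in> {..<t}" using assms(2) by simp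
    then have "\<phi> (?\<psi> (?s (\<phi> v))) = ?s (\<phi> v)"
      using bij by (simp add: bij_betw_inv_into_right)
    moreover have "?\<psi> (?s (\<phi> v)) \<in> verts C"
      using s bij by (metis bij_betw_imp_surj_on inv_into_into)
    moreover have "{\<phi> v, ?s (\<phi> v)} \<in> edges (cycle_graph t)"
      using \<phi>v by (auto simp: cycle_graph_def)
    ultimately show ?thesis using edge[OF v] by simp
  qed
  ultimately show ?thesis by blast
qed

text \<open>Adjacency is symmetric, so reachability is an equivalence relation.\<close>

lemma component_of_eqI:
  assumes "(v, w) \<in> (adj H)\<^sup>*"
  shows "component_of H w = component_of H v"
proof -
  have "sym (adj H)" by (auto simp: sym_def adj_def insert_commute)
  then have "(w, v) \<in> (adj H)\<^sup>*" using assms by (metis sym_rtrancl symD)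
  then have "(w, u) \<in> (adj H)\<^sup>* \<longleftrightarrow> (v, u) \<in> (adj H)\<^sup>*" for u
    using assms by (meson rtrancl_trans)
  then show ?thesis by (simp add: component_of_def)
qed

text \<open>The bijections are glued along the components. Images stay in the component, so vertices
  with equal images share a component, where the bijection separates them.\<close>

lemma components_edge_permutation:
  assumes H: "simple_graph H"
    and "\<And>C. C \<in> components H \<Longrightarrow>
      \<exists>\<sigma>. bij_betw \<sigma> (verts C) (verts C) \<and> (\<forall>v\<in>verts C. {v, \<sigma> v} \<in> edges C)"
  shows "\<exists>\<sigma>. edge_permutation H \<sigma>"
proof -
  \<comment> \<open>One bijection is chosen per component, so all its vertices are moved by the same
    map.\<close>
  obtain s where bij: "\<And>C. C \<in> components H \<Longrightarrow> bij_betw (s C) (verts C) (verts C)"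
    and edge: "\<And>C v. C \<in> components H \<Longrightarrow> v \<in> verts C \<Longrightarrow> {v, s C v} \<in> edges C"
    using assms(2) by metis
  let ?c = "component_of H"
  define \<sigma> where "\<sigma> v = s (?c v) v" for v
  have comp: "?c v \<in> components H" and self: "v \<in> verts (?c v)" if "v \<in> verts H" for v
    using that by (auto simp: components_def component_of_def)
  have \<sigma>c: "\<sigma> v \<in> verts (?c v)" if "v \<in> verts H" for v
    using bij[OF comp] self that unfolding \<sigma>_def by (meson bij_betwE)
  then have \<sigma>V: "\<sigma> v \<in> verts H" and same: "?c (\<sigma> v) = ?c v" if "v \<in> verts H" for v
    using that component_of_eqI[of v "\<sigma> v" H] by (auto simp: component_of_def)
  have "inj_on \<sigma> (verts H)"
  proof (rule inj_onI)
    fix u w assume uw: "u \<in> verts H" "w \<in> verts H" "\<sigma> u = \<sigma> w"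
    then have "?c u = ?c w" using same by metis
    then show "u = w"
      using uw bij[OF comp[OF uw(1)]] self[of u] self[of w]
      unfolding \<sigma>_def bij_betw_def by (metis inj_onD)
  qed
  moreover have "finite (verts H)" using H by (simp add: simple_graph_def)
  ultimately have "bij_betw \<sigma> (verts H) (verts H)"
    using \<sigma>V by (simp add: bij_betw_def endo_inj_surj image_subsetI)
  moreover have "\<forall>v\<in>verts H. {v, \<sigma> v} \<in> edges H"
    using edge[OF comp self] by (auto simp: \<sigma>_def component_of_def)
  ultimately show ?thesis by (rule bij_betw_imp_edge_permutation)
qed

lemma factor_imp_edge_permutation:
  assumes "has_factor ({complete_graph 2} \<union> {cycle_graph t |t. t \<ge> 3}) G"
  shows "\<exists>\<sigma>. edge_permutation G \<sigma>"
proof -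
  obtain H where H: "spanning_subgraph H G"
    and iso: "\<And>C. C \<in> components H \<Longrightarrow>
      \<exists>F \<in> {complete_graph 2} \<union> {cycle_graph t |t. t \<ge> 3}. graph_iso C F"
    using assms unfolding has_factor_def by blast
  have "\<exists>\<sigma>. bij_betw \<sigma> (verts C) (verts C) \<and> (\<forall>v\<in>verts C. {v, \<sigma> v} \<in> edges C)"
    if C: "C \<in> components H" for C
  proof -
    have "\<exists>t \<ge> 2. graph_iso C (cycle_graph t)"
    proof -
      have "2 \<le> t" if "3 \<le> t" for t :: nat using that by simp
      then show ?thesis
        using iso[OF C] order_refl[of "2 :: nat"] unfolding complete_graph_2 by blast
    qed
    then obtain t where "t \<ge> 2" "graph_iso C (cycle_graph t)" by blast
    then show ?thesis by (intro iso_cycle_graph_shift)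
  qed
  moreover have "simple_graph H" using H by (simp add: spanning_subgraph_def)
  ultimately obtain \<sigma> where "edge_permutation H \<sigma>"
    using components_edge_permutation[of H] by blast
  then have "edge_permutation G \<sigma>"
    using H by (auto simp: spanning_subgraph_def edge_permutation_def)
  then show ?thesis by blast
qed

section \<open>Matchings and edge permutations\<close>

lemma edge_permutation_imp_perfect_k_matching:
  fixes k :: nat
  assumes G: "simple_graph G" and \<sigma>: "edge_permutation G \<sigma>" and "even k"
  shows "\<exists>f. perfect_k_matching k G f"
proof -
  \<comment> \<open>These vertices give their share \<open>k div 2\<close> to \<open>e\<close>.
    There are two of them exactly when \<open>\<sigma>\<close> swaps the ends of the edge, which
    then receives all of \<open>k\<close>.\<close>
  define V where "V e = {v \<in> verts G. {v, \<sigma> v} = e}" for e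
  define f where "f e = k div 2 * card (V e)" for e
  have finV: "finite (V e)" for e using G by (simp add: V_def simple_graph_def)
  have finI: "finite (incident_edges G v)" for v
    using finite_edges[OF G] by (simp add: incident_edges_def)
  have perm: "\<sigma> permutes verts G" using \<sigma> by (simp add: edge_permutation_def)
  have total: "(\<Sum>e \<in> incident_edges G w. f e) = k" if w: "w \<in> verts G" for w
  proof -
    have iw: "inv \<sigma> w \<in> verts G" "\<sigma> (inv \<sigma> w) = w"
      using w permutes_in_image[OF permutes_inv[OF perm]] permutes_inverses(1)[OF perm] by auto
    \<comment> \<open>Each vertex gives to one edge only, so the sets are disjoint; at
      \<open>w\<close> the givers are \<open>w\<close> itself and its predecessor.\<close>
    have "(\<Sum>e \<in> incident_edges G w. card (V e)) = card (\<Union>e \<in> incident_edges G w. V e)"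
      using finI finV by (intro card_UN_disjoint[symmetric]) (auto simp: V_def)
    also have "(\<Union>e \<in> incident_edges G w. V e) = {w, inv \<sigma> w}"
    proof
      show "(\<Union>e \<in> incident_edges G w. V e) \<subseteq> {w, inv \<sigma> w}"
        using permutes_inverses(2)[OF perm] by (auto simp: V_def incident_edges_def)
      have "{v, \<sigma> v} \<in> edges G" if "v \<in> verts G" for v
        using \<sigma> that by (simp add: edge_permutation_def)
      from this[OF w] this[OF iw(1)] show "{w, inv \<sigma> w} \<subseteq> (\<Union>e \<in> incident_edges G w. V e)"
        using w iw by (auto simp: V_def incident_edges_def)
    qed
    also have "card \<dots> = 2"
    proof -
      have "{inv \<sigma> w, \<sigma> (inv \<sigma> w)} \<in> edges G"
        using \<sigma> iw(1) by (simp add: edge_permutation_def)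
      then have "inv \<sigma> w \<noteq> w" using edge_neq[OF G] iw(2) by metis
      then show ?thesis by simp
    qed
    finally show ?thesis
      using \<open>even k\<close> by (simp add: f_def flip: sum_distrib_left)
  qed
  have "f e \<le> k" if e: "e \<in> edges G" for e
  proof -
    obtain w where w: "w \<in> verts G" "w \<in> e" using e G unfolding simple_graph_def by blast
    \<comment> \<open>The upper bound on a single edge follows from the total at one of its
      ends.\<close>
    have "f e \<le> (\<Sum>e \<in> incident_edges G w. f e)"
      using e w finI by (intro member_le_sum) (auto simp: incident_edges_def)
    then show ?thesis using total w by simp
  qed
  then show ?thesis using total unfolding perfect_k_matching_def by auto
qed

lemma perfect_k_matching_imp_fractional:
  assumes "perfect_k_matching k G f" and "k > 0"
  shows "fractional_perfect_matching G (\<lambda>e. real (f e) / real k)"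
proof -
  have "(\<Sum>e \<in> incident_edges G v. real (f e) / real k) = 1" if "v \<in> verts G" for v
  proof -
    have "(\<Sum>e \<in> incident_edges G v. real (f e) / real k)
        = real (\<Sum>e \<in> incident_edges G v. f e) / real k"
      by (simp add: sum_divide_distrib)
    also have "\<dots> = 1" using assms that by (simp add: perfect_k_matching_def)
    finally show ?thesis .
  qed
  then show ?thesis
    using assms by (auto simp: fractional_perfect_matching_def perfect_k_matching_def)
qed

text \<open>Hall's condition by double counting: the vertices of \<open>S\<close> send out total
  weight \<open>card S\<close>, all of it to their neighbours, each of which can take at most
  1.\<close>

lemma fractional_perfect_matching_imp_edge_permutation:
  assumes G: "simple_graph G" and f: "fractional_perfect_matching G f"
  shows "\<exists>\<sigma>. edge_permutation G \<sigma>"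
proof -
  define N where "N v = {u. {v, u} \<in> edges G}" for v
  \<comment> \<open>The weighted adjacency matrix: symmetric and nonnegative, with row sums 1. It
    replaces sums over edges by sums over vertices, which can be interchanged.\<close>
  define g where "g v u = (if {v, u} \<in> edges G then f {v, u} else 0)" for v u
  have fin: "finite (verts G)" using G by (simp add: simple_graph_def)
  have NV: "N v \<subseteq> verts G" for v using edge_in_verts[OF G] by (auto simp: N_def)
  have g0: "0 \<le> g v u" for v u using f by (auto simp: g_def fractional_perfect_matching_def)
  have gsym: "g v u = g u v" for u v by (simp add: g_def insert_commute)
  have total: "(\<Sum>u \<in> verts G. g v u) = 1" if v: "v \<in> verts G" for v
  proof -
    have "(\<Sum>u \<in> verts G. g v u) = (\<Sum>u \<in> N v. g v u)"
      using fin NV by (intro sum.mono_neutral_right) (auto simp: N_def g_def)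
    also have "\<dots> = (\<Sum>u \<in> N v. f {v, u})" by (simp add: N_def g_def)
    also have "\<dots> = (\<Sum>e \<in> incident_edges G v. f e)"
    proof (rule sum.reindex_bij_betw)
      have "inj_on (\<lambda>u. {v, u}) (N v)" by (auto simp: inj_on_def doubleton_eq_iff)
      moreover have "(\<lambda>u. {v, u}) ` N v = incident_edges G v"
      proof
        show "(\<lambda>u. {v, u}) ` N v \<subseteq> incident_edges G v" by (auto simp: N_def incident_edges_def)
        show "incident_edges G v \<subseteq> (\<lambda>u. {v, u}) ` N v"
        proof
          fix e assume e: "e \<in> incident_edges G v"
          then obtain a b where "e = {a, b}" using G
            unfolding simple_graph_def incident_edges_def by blast
          then have "\<exists>u. e = {v, u}" using e by (auto simp: incident_edges_def)
          then show "e \<in> (\<lambda>u. {v, u}) ` N v" using e by (auto simp: N_def incident_edges_def)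
        qed
      qed
      ultimately show "bij_betw (\<lambda>u. {v, u}) (N v) (incident_edges G v)"
        by (simp add: bij_betw_def)
    qed
    also have "\<dots> = 1" using f v by (simp add: fractional_perfect_matching_def)
    finally show ?thesis .
  qed
  have "\<exists>R. inj_on R (verts G) \<and> (\<forall>v\<in>verts G. R v \<in> N v)"
  proof (rule hall_marriage)
    show "finite (N v)" for v using NV fin by (rule finite_subset)
    show "card S \<le> card (\<Union>(N ` S))" if S: "S \<subseteq> verts G" for S
    proof -
      let ?NS = "\<Union>(N ` S)"
      have NSV: "?NS \<subseteq> verts G" using NV by blast
      have "real (card S) = (\<Sum>v \<in> S. \<Sum>u \<in> verts G. g v u)"
        using total S by (simp add: subset_iff)
      also have "\<dots> = (\<Sum>v \<in> S. \<Sum>u \<in> ?NS. g v u)"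
        using fin NSV by (intro sum.cong refl sum.mono_neutral_right) (auto simp: N_def g_def)
      also have "\<dots> = (\<Sum>u \<in> ?NS. \<Sum>v \<in> S. g u v)"
        by (subst sum.swap) (simp add: gsym)
      \<comment> \<open>Enlarging \<open>S\<close> to all vertices adds only nonnegative terms and
        completes each row sum to 1.\<close>
      also have "\<dots> \<le> (\<Sum>u \<in> ?NS. \<Sum>v \<in> verts G. g u v)"
        using fin S g0 by (intro sum_mono sum_mono2) auto
      also have "\<dots> = real (card ?NS)"
        using total NSV by (simp add: subset_iff)
      finally show ?thesis by simp
    qed
  qed (rule fin)
  then obtain \<sigma> where inj: "inj_on \<sigma> (verts G)" and \<sigma>: "\<And>v. v \<in> verts G \<Longrightarrow> \<sigma> v \<in> N v" by blast
  \<comment> \<open>Representatives are vertices again, and an injective self-map of a finite set is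
    a bijection.\<close>
  have "\<sigma> ` verts G \<subseteq> verts G" using \<sigma> NV by blast
  then have "bij_betw \<sigma> (verts G) (verts G)"
    using fin inj by (simp add: bij_betw_def endo_inj_surj)
  moreover have "\<forall>v\<in>verts G. {v, \<sigma> v} \<in> edges G" using \<sigma> by (simp add: N_def)
  ultimately show ?thesis by (rule bij_betw_imp_edge_permutation)
qed

section \<open>Combining the implications\<close>

lemma has_factor_mono: "\<A> \<subseteq> \<B> \<Longrightarrow> has_factor \<A> G \<Longrightarrow> has_factor \<B> G"
  unfolding has_factor_def by blast

theorem theorem6p3:
  fixes G :: "'a graph" and k :: nat
  assumes "simple_graph G"
    and "connected_graph G"
    and "k \<ge> 2"
    and "even k"
  shows "(has_factor ({complete_graph 2} \<union> {cycle_graph t |t. t \<ge> 3}) G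
            \<longleftrightarrow> has_factor ({complete_graph 2} \<union> {cycle_graph (2 * t + 1) |t. t \<ge> 1}) G) \<and>
         (has_factor ({complete_graph 2} \<union> {cycle_graph (2 * t + 1) |t. t \<ge> 1}) G
            \<longleftrightarrow> (\<exists>f. fractional_perfect_matching G f)) \<and>
         ((\<exists>f. fractional_perfect_matching G f)
            \<longleftrightarrow> (\<exists>f. perfect_k_matching k G f))"
    (is "(?cycles \<longleftrightarrow> ?odd) \<and> (?odd \<longleftrightarrow> ?frac) \<and> (?frac \<longleftrightarrow> ?kmatch)")
proof -
  \<comment> \<open>Two cycles of implications meet in \<open>?perm\<close>: one through
    \<open>?odd\<close> and \<open>?cycles\<close>, the other through \<open>?kmatch\<close> and
    \<open>?frac\<close>.\<close>
  let ?perm = "\<exists>\<sigma>. edge_permutation G \<sigma>"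
  have "?perm \<Longrightarrow> ?odd" using edge_permutation_imp_factor[OF assms(1)] by blast
  moreover have "?odd \<Longrightarrow> ?cycles"
  proof (rule has_factor_mono)
    have "2 * t + 1 \<ge> 3" if "t \<ge> 1" for t :: nat using that by linarith
    then show "{complete_graph 2} \<union> {cycle_graph (2 * t + 1) |t. t \<ge> 1}
        \<subseteq> {complete_graph 2} \<union> {cycle_graph t |t. t \<ge> 3}" by blast
  qed
  moreover have "?cycles \<Longrightarrow> ?perm" by (rule factor_imp_edge_permutation)
  moreover have "?perm \<Longrightarrow> ?kmatch"
    using edge_permutation_imp_perfect_k_matching[OF assms(1)] assms(4) by blast
  moreover have "?kmatch \<Longrightarrow> ?frac"
  proof -
    have "k > 0" using assms(3) by simp
    then show "?kmatch \<Longrightarrow> ?frac" using perfect_k_matching_imp_fractional by blast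
  qed
  moreover have "?frac \<Longrightarrow> ?perm"
    using fractional_perfect_matching_imp_edge_permutation[OF assms(1)] by blast
  ultimately show ?thesis by blast
qed

end
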